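(* Consider a network with $L$ control sites. For each $k\in\{1,\dots,L\}$ let the control be a low-rank projection $\Delta W_k=B_kA_k$ with $\|B_k\|\le\beta_k$ and $\|A_k\|\le\gamma$. Let the router select, for a state $x$, a top-$K$ index set $S_K(x)\subseteq\{1,\dots,L\}$ with routing weights $\pi_k(x)$, and define the effective routed magnitude $\beta_K(x)=\sum_{k\in S_K(x)}\pi_k(x)\beta_k$. Let $L_f$ bound the Lipschitz contribution of the frozen dynamics, i.e. $\|f_t(W_tx)\|\le L_f\|x\|$ for all $x\in\mathbb{R}^d$ and all $t$. Let $\{x_t^c\}_{t=1}^{L+1}$ and $\{x_t\}_{t=1}^{L+1}$ be the representations produced by Parallel Control and by MoC with mixing coefficient $\alpha\in[0,1]$, respectively, i.e. for $t=1,\dots,L$, $$x_{t+1}^c=x_t^c+f_t(W_tx_t^c)+\Delta W_tx_t^c,$$ $$x_{t+1}=x_t+f_t(W_tx_t)+\alpha\,\Delta W_tx_t+(1-\alpha)\sum_{k\in S_K(x_t)}\pi_k(x_t)\,\Delta W_kx_t.$$ Then for each $t$, $$\|x_{t+1}^c\|\le(1+L_f+\beta_t\gamma)\|x_t^c\|,$$ whereas MoC with mixing coefficient $\alpha\in[0,1]$ satisfies $$\|x_{t+1}\|\le\big(1+L_f+\alpha\beta_t\gamma+(1-\alpha)\beta_K(x_t)\gamma\big)\|x_t\|.$$ Moreover, if $x_1=x_1^c$ and the router selects experts such that $\mathbb{E}[\beta_K(x_t)\mid x_t]<\beta_t$, then MoC admits a strictly tighter expected one-step growth factor: $$1+L_f+\big[\alpha\beta_t+(1-\alpha)\mathbb{E}[\beta_K(x_t)\mid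 x_t]\big]\gamma<1+L_f+\beta_t\gamma.$$ Thus, effective routing yields more stable forward dynamics by replacing a fixed local control norm with a data-dependent routed norm.
   Context: States lie in $\mathbb{R}^d$; $\|\cdot\|$ is the Euclidean norm on vectors and the operator norm on matrices. MoC (Mixture-of-Control) and Parallel Control are the two update rules displayed in the claim. At block $t$, $W_t$ is the frozen pretrained weight and $f_t$ the frozen block dynamics. Each control $\Delta W_k=B_kA_k\in\mathbb{R}^{d\times d}$ is a product with $B_k\in\mathbb{R}^{d\times r}$, $A_k\in\mathbb{R}^{r\times d}$. Top-$K$ routing: given a shared gating matrix $\mathbf{W}_{\text{gate}}\in\mathbb{R}^{L\times d}$, $S_K(x)$ is the set of indices of the $K$ largest entries of $\mathbf{W}_{\text{gate}}x$, and $\pi_k(x)=\exp((\mathbf{W}_{\text{gate}}x)_k)/\sum_{j\in S_K(x)}\exp((\mathbf{W}_{\text{gate}}x)_j)$ for $k\in S_K(x)$, $\pi_k(x)=0$ otherwise; thus $\pi_k(x)\ge0$ and $\sum_{k\in S_K(x)}\pi_k(x)=1$. Expectations are with respect to the data distribution.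
   Formalization: The strict inequality is proved under the added assumptions α < 1 and γ > 0, since for α = 1 or γ = 0 both sides equal 1 + L_f + β_tγ; the closing interpretive sentence on stability is not formalized. *)

theory Defs
  imports "HOL-Probability.Probability"
begin

text \<open>
  Control sites are the indices \<open>1..L\<close>. The gating matrix (an \<open>L \<times> d\<close> matrix, with
  \<open>L\<close> a natural number rather than a type) is given by its rows \<open>G k\<close>, so the \<open>k\<close>-th
  entry of its product with \<open>x\<close> is \<open>G k \<bullet> x\<close>.
\<close>

definition gate_logit :: "(nat \<Rightarrow> real ^ 'd) \<Rightarrow> real ^ 'd \<Rightarrow> nat \<Rightarrow> real" where
  "gate_logit G x k = G k \<bullet> x"

text \<open>
  With tied entries there can be several sets of \<open>K\<close> largest entries. Hence this is a
  predicate: a router is any function choosing one such set for every state.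
\<close>

definition is_top_K :: "nat \<Rightarrow> nat \<Rightarrow> (nat \<Rightarrow> real ^ 'd) \<Rightarrow> real ^ 'd \<Rightarrow> nat set \<Rightarrow> bool" where
  "is_top_K L K G x I \<longleftrightarrow>
     I \<subseteq> {1..L} \<and> card I = K \<and>
     (\<forall>i\<in>I. \<forall>j\<in>{1..L} - I. gate_logit G x j \<le> gate_logit G x i)"

definition routing_weight ::
    "(nat \<Rightarrow> real ^ 'd) \<Rightarrow> (real ^ 'd \<Rightarrow> nat set) \<Rightarrow> nat \<Rightarrow> real ^ 'd \<Rightarrow> real" where
  "routing_weight G S k x =
     (if k \<in> S x then exp (gate_logit G x k) / (\<Sum>j\<in>S x. exp (gate_logit G x j)) else 0)"

definition routed_magnitude ::
    "(nat \<Rightarrow> real ^ 'd) \<Rightarrow> (real ^ 'd \<Rightarrow> nat set) \<Rightarrow> (nat \<Rightarrow> real) \<Rightarrow> real ^ 'd \<Rightarrow> real" where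
  "routed_magnitude G S \<beta> x = (\<Sum>k\<in>S x. routing_weight G S k x * \<beta> k)"

definition control :: "(nat \<Rightarrow> real ^ 'r ^ 'd) \<Rightarrow> (nat \<Rightarrow> real ^ 'd ^ 'r) \<Rightarrow> nat \<Rightarrow> real ^ 'd ^ 'd" where
  "control B A k = B k ** A k"

text \<open>
  The operator norm for the Euclidean norms; \<open>norm\<close> on the matrix type is the Frobenius
  norm.
\<close>

definition op_norm :: "real ^ 'n ^ 'm \<Rightarrow> real" where
  "op_norm A = onorm ((*v) A)"

text \<open>The conditional expectation \<open>E[Y | X]\<close>, i.e. given the sigma-algebra generated by \<open>X\<close>.\<close>

definition cond_exp_given ::
    "'w measure \<Rightarrow> ('w \<Rightarrow> 'b::topological_space) \<Rightarrow> ('w \<Rightarrow> real) \<Rightarrow> 'w \<Rightarrow> real" where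
  "cond_exp_given M X Y = real_cond_exp M (vimage_algebra (space M) X borel) Y"

end

theory Submission
  imports Defs
begin

text \<open>Both growth bounds come from the triangle inequality applied to one update. The routing
  weights are nonnegative, so the routed sum is bounded by the same weighted sum of the individual
  control bounds, which is exactly the routed magnitude times \<gamma> \<parallel>y\<parallel>
  (\<open>norm_routed_control_le\<close>).

  The MoC growth factor is affine in the routed magnitude, so conditioning on the state merely
  replaces that magnitude by its conditional expectation (\<open>cond_exp_given_affine\<close>).
  This requires integrability, which holds because weights in [0,1] keep the magnitude below a
  constant independent of the state (\<open>abs_routed_magnitude_le\<close>). The strict comparison
  is then pointwise algebra: a convex combination of \<beta> and a smaller number, with positive
  weight on the latter, lies strictly below \<beta>.\<close>

lemma norm_matrix_vector_le_op_norm: "norm (A *v x) \<le> op_norm A * norm x"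
  unfolding op_norm_def by (rule onorm) simp

lemma op_norm_nonneg: "0 \<le> op_norm A"
  unfolding op_norm_def by (rule onorm_pos_le) simp

lemma norm_control_le:
  assumes "op_norm (B k) \<le> b" and "op_norm (A k) \<le> c"
  shows "norm (control B A k *v y) \<le> b * c * norm y"
proof -
  \<comment> \<open>Nonnegativity of \<open>b\<close> is inherited from the operator norm it
    dominates; the final step needs it to multiply the bound on \<open>A k *v y\<close> by
    \<open>b\<close>.\<close>
  have b: "0 \<le> b"
    using op_norm_nonneg assms(1) by (rule order_trans)
  have "norm (control B A k *v y) = norm (B k *v (A k *v y))"
    by (simp add: control_def matrix_vector_mul_assoc)
  also have "\<dots> \<le> op_norm (B k) * norm (A k *v y)"
    by (rule norm_matrix_vector_le_op_norm)
  also have "\<dots> \<le> b * norm (A k *v y)"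
    by (intro mult_right_mono assms) simp
  also have "norm (A k *v y) \<le> op_norm (A k) * norm y"
    by (rule norm_matrix_vector_le_op_norm)
  also have "\<dots> \<le> c * norm y"
    by (intro mult_right_mono assms) simp
  finally show ?thesis
    using b by (simp add: mult_left_mono mult.assoc)
qed

lemma routing_weight_nonneg: "0 \<le> routing_weight G S k y"
  by (simp add: routing_weight_def sum_nonneg)

text \<open>The numerator is one of the positive terms of the denominator; finiteness makes the
  denominator a genuine sum rather than the default value 0.\<close>

lemma routing_weight_le_1:
  assumes "finite (S y)"
  shows "routing_weight G S k y \<le> 1"
proof (cases "k \<in> S y")
  case True
  have "exp (gate_logit G y k) \<le> (\<Sum>j\<in>S y. exp (gate_logit G y j))"
    using assms True by (intro member_le_sum) auto
  moreover have "0 < exp (gate_logit G y k)"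
    by simp
  ultimately have "exp (gate_logit G y k) / (\<Sum>j\<in>S y. exp (gate_logit G y j)) \<le> 1"
    by (subst divide_le_eq_1_pos) linarith+
  then show ?thesis
    by (simp add: routing_weight_def)
qed (simp add: routing_weight_def)

text \<open>The bound does not depend on \<open>y\<close>, which makes the routed magnitude of a
  random state a bounded random variable.\<close>

lemma abs_routed_magnitude_le:
  assumes "S y \<subseteq> I" and "finite I"
  shows "\<bar>routed_magnitude G S \<beta> y\<bar> \<le> (\<Sum>k\<in>I. \<bar>\<beta> k\<bar>)"
proof -
  have fin: "finite (S y)"
    using assms by (rule finite_subset)
  have "\<bar>routed_magnitude G S \<beta> y\<bar> \<le> (\<Sum>k\<in>S y. \<bar>routing_weight G S k y * \<beta> k\<bar>)"
    unfolding routed_magnitude_def by (rule sum_abs)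
  also have "\<dots> \<le> (\<Sum>k\<in>S y. \<bar>\<beta> k\<bar>)"
    by (intro sum_mono)
      (simp add: abs_mult routing_weight_nonneg routing_weight_le_1[where S = S and y = y, OF fin] mult_left_le_one_le)
  also have "\<dots> \<le> (\<Sum>k\<in>I. \<bar>\<beta> k\<bar>)"
    using assms by (intro sum_mono2) auto
  finally show ?thesis .
qed

text \<open>Multiplying each control bound by its nonnegative weight preserves the inequality; the
  common factor \<gamma> \<parallel>y\<parallel> then leaves the sum.\<close>

lemma norm_routed_control_le:
  assumes "\<And>k. k \<in> S y \<Longrightarrow> op_norm (B k) \<le> \<beta> k"
    and "\<And>k. k \<in> S y \<Longrightarrow> op_norm (A k) \<le> \<gamma>"
  shows "norm (\<Sum>k\<in>S y. routing_weight G S k y *\<^sub>R (control B A k *v y))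
    \<le> routed_magnitude G S \<beta> y * \<gamma> * norm y"
proof -
  have "norm (\<Sum>k\<in>S y. routing_weight G S k y *\<^sub>R (control B A k *v y))
    \<le> (\<Sum>k\<in>S y. routing_weight G S k y * (\<beta> k * \<gamma> * norm y))"
    by (intro sum_norm_le)
      (simp add: routing_weight_nonneg mult_left_mono norm_control_le assms)
  also have "\<dots> = routed_magnitude G S \<beta> y * \<gamma> * norm y"
    by (simp add: routed_magnitude_def sum_distrib_right mult.assoc)
  finally show ?thesis .
qed

text \<open>Conditional expectation is linear almost everywhere and fixes constants. Measurability
  of \<open>X\<close> puts its generated sigma-algebra inside that of \<open>M\<close>, and
  finiteness of the measure makes constants integrable.\<close>

lemma (in finite_measure) cond_exp_given_affine:
  assumes X: "X \<in> borel_measurable M" and Y: "integrable M Y"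
  shows "AE \<omega> in M. cond_exp_given M X (\<lambda>\<omega>. a + b * Y \<omega>) \<omega> = a + b * cond_exp_given M X Y \<omega>"
proof -
  let ?F = "vimage_algebra (space M) X borel"
  \<comment> \<open>With this typing the generated sigma-algebra consists exactly of the preimages
    of Borel sets under \<open>X\<close>.\<close>
  have "X \<in> space M \<rightarrow> space borel"
    by simp
  then have "subalgebra M ?F"
    using X by (auto simp: subalgebra_def sets_vimage_algebra2 measurable_sets)
  then interpret finite_measure_subalgebra M ?F
    by unfold_locales
  have "AE \<omega> in M. real_cond_exp M ?F (\<lambda>\<omega>. a + b * Y \<omega>) \<omega>
      = real_cond_exp M ?F (\<lambda>_. a) \<omega> + real_cond_exp M ?F (\<lambda>\<omega>. b * Y \<omega>) \<omega>"
    using Y by (intro real_cond_exp_add) auto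
  \<comment> \<open>A constant is measurable for every sigma-algebra, hence is its own conditional
    expectation.\<close>
  moreover have "AE \<omega> in M. real_cond_exp M ?F (\<lambda>_. a) \<omega> = a"
    by (intro real_cond_exp_F_meas) auto
  moreover have "AE \<omega> in M. real_cond_exp M ?F (\<lambda>\<omega>. b * Y \<omega>) \<omega> = b * real_cond_exp M ?F Y \<omega>"
    using Y by (rule real_cond_exp_cmult)
  ultimately show ?thesis
    unfolding cond_exp_given_def by eventually_elim simp
qed

theorem proposition4p2:
  fixes L K :: nat
    and W :: "nat \<Rightarrow> real ^ 'd ^ 'm"
    and f :: "nat \<Rightarrow> real ^ 'm \<Rightarrow> real ^ 'd"
    and B :: "nat \<Rightarrow> real ^ 'r ^ 'd"
    and A :: "nat \<Rightarrow> real ^ 'd ^ 'r"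
    and G :: "nat \<Rightarrow> real ^ 'd"
    and S :: "real ^ 'd \<Rightarrow> nat set"
    and \<beta> :: "nat \<Rightarrow> real"
    and \<gamma> L\<^sub>f \<alpha> :: real
    and M :: "'w measure"
    and x xc :: "nat \<Rightarrow> 'w \<Rightarrow> real ^ 'd"
  assumes K: "1 \<le> K" "K \<le> L"
    and B_bound: "\<And>k. k \<in> {1..L} \<Longrightarrow> op_norm (B k) \<le> \<beta> k"
    and A_bound: "\<And>k. k \<in> {1..L} \<Longrightarrow> op_norm (A k) \<le> \<gamma>"
    and router: "\<And>y. is_top_K L K G y (S y)"
    and frozen: "\<And>t y. t \<in> {1..L} \<Longrightarrow> norm (f t (W t *v y)) \<le> L\<^sub>f * norm y"
    and \<alpha>: "0 \<le> \<alpha>" "\<alpha> \<le> 1"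
    and M: "prob_space M"
    and parallel: "\<And>t \<omega>. t \<in> {1..L} \<Longrightarrow> \<omega> \<in> space M \<Longrightarrow>
          xc (t + 1) \<omega> = xc t \<omega> + f t (W t *v xc t \<omega>) + control B A t *v xc t \<omega>"
    and moc: "\<And>t \<omega>. t \<in> {1..L} \<Longrightarrow> \<omega> \<in> space M \<Longrightarrow>
          x (t + 1) \<omega> = x t \<omega> + f t (W t *v x t \<omega>) + \<alpha> *\<^sub>R (control B A t *v x t \<omega>)
            + (1 - \<alpha>) *\<^sub>R (\<Sum>k\<in>S (x t \<omega>). routing_weight G S k (x t \<omega>) *\<^sub>R (control B A k *v x t \<omega>))"
  shows
    "(\<forall>t\<in>{1..L}. \<forall>\<omega>\<in>space M.
        norm (xc (t + 1) \<omega>) \<le> (1 + L\<^sub>f + \<beta> t * \<gamma>) * norm (xc t \<omega>)) \<and>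
     (\<forall>t\<in>{1..L}. \<forall>\<omega>\<in>space M.
        norm (x (t + 1) \<omega>)
          \<le> (1 + L\<^sub>f + \<alpha> * \<beta> t * \<gamma> + (1 - \<alpha>) * routed_magnitude G S \<beta> (x t \<omega>) * \<gamma>) * norm (x t \<omega>)) \<and>
     ((AE \<omega> in M. x 1 \<omega> = xc 1 \<omega>) \<longrightarrow>
      (\<forall>t\<in>{1..L}.
         x t \<in> borel_measurable M \<longrightarrow>
         (\<lambda>\<omega>. routed_magnitude G S \<beta> (x t \<omega>)) \<in> borel_measurable M \<longrightarrow>
         (let E = cond_exp_given M (x t) (\<lambda>\<omega>. routed_magnitude G S \<beta> (x t \<omega>)) in
          (AE \<omega> in M.
             cond_exp_given M (x t)
               (\<lambda>\<omega>. 1 + L\<^sub>f + \<alpha> * \<beta> t * \<gamma> + (1 - \<alpha>) * routed_magnitude G S \<beta> (x t \<omega>) * \<gamma>) \<omega>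
             = 1 + L\<^sub>f + (\<alpha> * \<beta> t + (1 - \<alpha>) * E \<omega>) * \<gamma>) \<and>
          (\<alpha> < 1 \<longrightarrow> 0 < \<gamma> \<longrightarrow>
             (AE \<omega> in M. E \<omega> < \<beta> t \<longrightarrow>
                1 + L\<^sub>f + (\<alpha> * \<beta> t + (1 - \<alpha>) * E \<omega>) * \<gamma> < 1 + L\<^sub>f + \<beta> t * \<gamma>)))))"
proof -
  interpret prob_space M by (rule M)
  have S: "S y \<subseteq> {1..L}" for y
    using router[of y] by (simp add: is_top_K_def)
  have control_le: "norm (control B A t *v y) \<le> \<beta> t * \<gamma> * norm y" if "t \<in> {1..L}" for t y
    by (intro norm_control_le B_bound A_bound that)
  have routed_le: "norm (\<Sum>k\<in>S y. routing_weight G S k y *\<^sub>R (control B A k *v y))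
      \<le> routed_magnitude G S \<beta> y * \<gamma> * norm y" for y
    using S by (intro norm_routed_control_le B_bound A_bound) blast+
  have 1: "norm (xc (t + 1) \<omega>) \<le> (1 + L\<^sub>f + \<beta> t * \<gamma>) * norm (xc t \<omega>)"
    if t: "t \<in> {1..L}" and \<omega>: "\<omega> \<in> space M" for t \<omega>
  proof -
    let ?y = "xc t \<omega>"
    have "norm (xc (t + 1) \<omega>)
        \<le> norm ?y + norm (f t (W t *v ?y)) + norm (control B A t *v ?y)"
      unfolding parallel[OF t \<omega>] by (intro norm_triangle_le add_right_mono norm_triangle_ineq)
    also have "\<dots> \<le> norm ?y + L\<^sub>f * norm ?y + \<beta> t * \<gamma> * norm ?y"
      by (intro add_mono order_refl frozen control_le t)
    finally show ?thesis
      by (simp add: algebra_simps)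
  qed
  have 2: "norm (x (t + 1) \<omega>)
      \<le> (1 + L\<^sub>f + \<alpha> * \<beta> t * \<gamma> + (1 - \<alpha>) * routed_magnitude G S \<beta> (x t \<omega>) * \<gamma>) * norm (x t \<omega>)"
    if t: "t \<in> {1..L}" and \<omega>: "\<omega> \<in> space M" for t \<omega>
  proof -
    let ?y = "x t \<omega>"
    let ?u = "control B A t *v ?y"
    let ?v = "\<Sum>k\<in>S ?y. routing_weight G S k ?y *\<^sub>R (control B A k *v ?y)"
    have "norm (x (t + 1) \<omega>)
        \<le> norm ?y + norm (f t (W t *v ?y)) + norm (\<alpha> *\<^sub>R ?u) + norm ((1 - \<alpha>) *\<^sub>R ?v)"
      unfolding moc[OF t \<omega>] by (intro norm_triangle_le add_right_mono norm_triangle_ineq)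
    \<comment> \<open>As \<alpha> lies in [0,1], both mixing coefficients are nonnegative and leave
      the norms without absolute values.\<close>
    also have "\<dots> = norm ?y + norm (f t (W t *v ?y)) + \<alpha> * norm ?u + (1 - \<alpha>) * norm ?v"
      using \<alpha> by simp
    also have "\<dots> \<le> norm ?y + L\<^sub>f * norm ?y + \<alpha> * (\<beta> t * \<gamma> * norm ?y)
        + (1 - \<alpha>) * (routed_magnitude G S \<beta> ?y * \<gamma> * norm ?y)"
      using \<alpha> by (intro add_mono order_refl mult_left_mono frozen control_le routed_le t) auto
    finally show ?thesis
      by (simp add: algebra_simps)
  qed
  have 3: "AE \<omega> in M.
      cond_exp_given M (x t)
        (\<lambda>\<omega>. 1 + L\<^sub>f + \<alpha> * \<beta> t * \<gamma> + (1 - \<alpha>) * routed_magnitude G S \<beta> (x t \<omega>) * \<gamma>) \<omega>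
      = 1 + L\<^sub>f + (\<alpha> * \<beta> t
          + (1 - \<alpha>) * cond_exp_given M (x t) (\<lambda>\<omega>. routed_magnitude G S \<beta> (x t \<omega>)) \<omega>) * \<gamma>"
    if X: "x t \<in> borel_measurable M"
      and Y: "(\<lambda>\<omega>. routed_magnitude G S \<beta> (x t \<omega>)) \<in> borel_measurable M" for t
  proof -
    have "integrable M (\<lambda>\<omega>. routed_magnitude G S \<beta> (x t \<omega>))"
    proof (rule integrable_const_bound)
      show "AE \<omega> in M. norm (routed_magnitude G S \<beta> (x t \<omega>)) \<le> (\<Sum>k\<in>{1..L}. \<bar>\<beta> k\<bar>)"
        using S by (intro AE_I2) (simp add: abs_routed_magnitude_le del: One_nat_def)
    qed (rule Y)
    \<comment> \<open>The growth factor is read as a constant plus (1 - \<alpha>) \<gamma> times the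
      routed magnitude.\<close>
    from cond_exp_given_affine[OF X this, of "1 + L\<^sub>f + \<alpha> * \<beta> t * \<gamma>" "(1 - \<alpha>) * \<gamma>"]
    show ?thesis
      by (simp add: algebra_simps)
  qed
  have 4: "1 + L\<^sub>f + (\<alpha> * b + (1 - \<alpha>) * e) * \<gamma> < 1 + L\<^sub>f + b * \<gamma>"
    if "\<alpha> < 1" "0 < \<gamma>" "e < b" for b e
  proof -
    \<comment> \<open>Strictness enters here through 1 - \<alpha> > 0, and survives the later
      multiplication because \<gamma> > 0.\<close>
    have "(1 - \<alpha>) * e < (1 - \<alpha>) * b"
      using that by (intro mult_strict_left_mono) auto
    then have "\<alpha> * b + (1 - \<alpha>) * e < b"
      by (simp add: algebra_simps)
    then show ?thesis
      using that by simp
  qed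
  show ?thesis
    unfolding Let_def
    \<comment> \<open>Fact \<open>4\<close> holds for arbitrary reals, so the last almost-everywhere
      claim follows at every point of the space.\<close>
    by (intro conjI ballI impI 1 2 3 AE_I2[OF impI[OF 4]])
qed

end
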